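(* Let $f\colon [0,\infty)\to (0,\infty)$ be a non-decreasing function such that $\sum_{n=1}^{\infty} \frac{1}{f(2^n)}<\infty$. Let $0<r<2\leq p$ and let $q=2(p-r)/(2-r)$. Let $\{X_n\}_{n\geq 1}$ be a martingale difference sequence such that $\sup_{n\geq 1} \mathbb{E}(|X_n|^q f(|X_n|))<\infty$. Then for all $\varepsilon>0$ we have $$\sum_{n=1}^{\infty} n^{p/r-2}\, \mathbb{P}(M_n>\varepsilon n^{1/r})<\infty.$$
   Context: All random variables are real-valued and those in a sequence $\{X_n\}_{n\geq 1}$ are defined on the same probability space $(\Omega,\mathcal{F},\mathbb{P})$. For $n\geq 1$ let $S_n=\sum_{i=1}^n X_i$ and $M_n=\max_{1\leq i\leq n}|S_i|$. $\{X_n\}_{n\geq 1}$ is a martingale difference sequence if there is a filtration $\{\mathcal{F}_n\}_{n\geq 0}$ such that $\mathcal{F}_0=\{\emptyset,\Omega\}$, $X_n$ is (integrable and) $\mathcal{F}_n$-measurable, and $\mathbb{E}(X_n\,|\,\mathcal{F}_{n-1})=0$ for all $n\geq 1$. *)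

theory Defs
  imports "HOL-Probability.Probability"
begin

text \<open>Sequences of random variables are functions on \<^typ>\<open>nat\<close> whose terms of index \<open>n \<ge> 1\<close> matter;
  the value at index \<open>0\<close> is never used. The $\sigma$-algebra of index \<open>n\<close> is represented by a
  measure space of which only the space and the measurable sets matter.\<close>

definition martingale_difference_seq :: "'a measure \<Rightarrow> (nat \<Rightarrow> 'a \<Rightarrow> real) \<Rightarrow> bool" where
  "martingale_difference_seq M X \<longleftrightarrow>
    (\<exists>F :: nat \<Rightarrow> 'a measure.
       filtration (space M) F \<and> (\<forall>n. subalgebra M (F n)) \<and>
       sets (F 0) = {{}, space M} \<and>
       (\<forall>n\<ge>1. integrable M (X n) \<and> X n \<in> borel_measurable (F n) \<and>
               (AE \<omega> in M. real_cond_exp M (F (n - 1)) (X n) \<omega> = 0)))"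

definition partial_sum :: "(nat \<Rightarrow> 'a \<Rightarrow> real) \<Rightarrow> nat \<Rightarrow> 'a \<Rightarrow> real" where
  "partial_sum X n \<omega> = (\<Sum>i = 1..n. X i \<omega>)"

text \<open>Meaningful for \<open>n \<ge> 1\<close> only, since \<^const>\<open>Max\<close> of the empty set is unspecified.\<close>

definition max_partial_sum :: "(nat \<Rightarrow> 'a \<Rightarrow> real) \<Rightarrow> nat \<Rightarrow> 'a \<Rightarrow> real" where
  "max_partial_sum X n \<omega> = Max ((\<lambda>i. \<bar>partial_sum X i \<omega>\<bar>) ` {1..n})"

end

theory Submission
  imports Defs
begin

text \<open>Stopping the martingale when \<open>\<bar>S\<^sub>j\<bar>\<close> first exceeds \<open>c = \<epsilon> n\<^bsup>1/r\<^esup>\<close> turns the event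
  \<open>M\<^sub>n > c\<close> into a deviation of a single partial sum, so no maximal inequality is needed.
  The stopped differences are truncated at level \<open>b = n\<^bsup>1/N\<^esup>\<close>, where \<open>1/N < \<kappa> = 1/r - 1/2\<close>, and
  both parts are centred by their conditional expectations.
  For \<open>s \<ge> 2\<close>, martingale differences with \<open>s\<close>-th moments at most \<open>L\<close> satisfy
  \<open>E \<bar>S\<^sub>n\<bar>\<^bsup>s\<^esup> \<le> C\<^sub>s n\<^bsup>s/2\<^esup> L\<close>, so Markov's inequality yields the factor \<open>n\<^bsup>-s\<kappa>\<^esup> L\<close>.
  Since \<open>q\<kappa> = p/r - 1\<close>, the exponent \<open>s = q\<close> is borderline: the large part, whose \<open>q\<close>-th moments
  are of order \<open>1/f(b)\<close>, contributes \<open>1/(n f(n\<^bsup>1/N\<^esup>))\<close>, which is summable by Cauchy condensation.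
  The small part, taken with \<open>s = q + 1\<close> and moments of order \<open>b\<close>, contributes
  \<open>n\<^bsup>-1-(\<kappa>-1/N)\<^esup>\<close>.\<close>

section \<open>Elementary inequalities for real powers\<close>

lemma exp_le_quadratic:
  fixes x :: real
  assumes "\<bar>x\<bar> \<le> 1"
  shows "exp x \<le> 1 + x + x\<^sup>2"
proof (cases "x \<ge> 0")
  case True
  then show ?thesis using exp_bound[of x] assms by simp
next
  case False
  define y where "y = - x"
  have y: "0 \<le> y" "y \<le> 1" using False assms by (auto simp: y_def)
  have "1 + y + y\<^sup>2 / 2 \<le> exp y" 
    using exp_lower_Taylor_quadratic[of y] y by simp
  \<comment> \<open>A lower bound for \<open>exp y\<close> whose product with 1 - y + y^2 is at
    least 1 makes 1 - y + y^2 an upper bound for \<open>exp (- y)\<close>.\<close>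
  moreover have "1 \<le> (1 + y + y\<^sup>2 / 2) * (1 - y + y\<^sup>2)"
  proof -
    have "(1 + y + y\<^sup>2 / 2) * (1 - y + y\<^sup>2) = 1 + y\<^sup>2 / 2 * (1 + y + y\<^sup>2)"
      by (simp add: field_simps power2_eq_square)
    with y show ?thesis by simp
  qed
  moreover have "0 < 1 - y + y\<^sup>2" using y by (cases "y = 1") (auto intro: add_pos_nonneg)
  ultimately have "1 \<le> exp y * (1 - y + y\<^sup>2)"
    by (meson less_eq_real_def mult_right_mono order_trans)
  then have "exp (- y) \<le> 1 - y + y\<^sup>2"
    by (simp add: exp_minus field_simps)
  then show ?thesis by (simp add: y_def)
qed

lemma one_add_powr_le:
  fixes s t :: real
  assumes "s \<ge> 2" "s * \<bar>t\<bar> \<le> 1"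
  shows "(1 + t) powr s \<le> 1 + s * t + s\<^sup>2 * t\<^sup>2"
proof -
  have "2 * \<bar>t\<bar> \<le> s * \<bar>t\<bar>" using assms by (intro mult_right_mono) auto
  then have t: "\<bar>t\<bar> < 1" using assms by linarith
  then have "(1 + t) powr s = exp (s * ln (1 + t))" by (simp add: powr_def)
  also have "\<dots> \<le> exp (s * t)"
    using t assms by (auto intro!: mult_left_mono ln_add_one_self_le_self2)
  also have "\<dots> \<le> 1 + s * t + (s * t)\<^sup>2"
    using assms by (intro exp_le_quadratic) (auto simp: abs_mult)
  finally show ?thesis by (simp add: power_mult_distrib)
qed

text \<open>The first-order term is kept exactly, with the derivative of |a|^s as coefficient, so
  that it can vanish in expectation when \<open>b\<close> is a martingale difference. If s|b| \<le>
  |a|, factoring out \<open>a\<close> reduces the claim to \<open>one_add_powr_le\<close>. Otherwise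
  |b|^s dominates: (1 + s)^s pays for the left side and s^s for a possibly negative first-order
  term.\<close>

lemma abs_powr_add_le:
  fixes a b s :: real
  assumes s: "s \<ge> 2"
  shows "\<bar>a + b\<bar> powr s \<le> \<bar>a\<bar> powr s + s * (sgn a * \<bar>a\<bar> powr (s - 1) * b)
    + s\<^sup>2 * (\<bar>a\<bar> powr (s - 2) * b\<^sup>2) + ((1 + s) powr s + s powr s) * \<bar>b\<bar> powr s"
proof (cases "s * \<bar>b\<bar> \<le> \<bar>a\<bar>")
  case True
  show ?thesis
  proof (cases "a = 0")
    case True
    with \<open>s * \<bar>b\<bar> \<le> \<bar>a\<bar>\<close> s show ?thesis by (simp add: mult_le_0_iff)
  next
    case False
    define t where "t = b / a"
    have b: "b = a * t" using False by (simp add: t_def)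
    have "s * \<bar>t\<bar> \<le> 1" using True False by (simp add: t_def field_simps)
    note * = one_add_powr_le[OF s this]
    have "2 * \<bar>t\<bar> \<le> s * \<bar>t\<bar>" using s by (intro mult_right_mono) auto
    then have t: "\<bar>t\<bar> < 1" using \<open>s * \<bar>t\<bar> \<le> 1\<close> by linarith
    have "\<bar>a + b\<bar> = \<bar>a\<bar> * (1 + t)"
      using t abs_mult[of a "1 + t"] by (simp add: b distrib_left)
    then have "\<bar>a + b\<bar> powr s = \<bar>a\<bar> powr s * (1 + t) powr s"
      using t by (simp add: powr_mult)
    also have "\<dots> \<le> \<bar>a\<bar> powr s * (1 + s * t + s\<^sup>2 * t\<^sup>2)"
      by (intro mult_left_mono *) auto
    also have "\<dots> = \<bar>a\<bar> powr s + s * (\<bar>a\<bar> powr s * t) + s\<^sup>2 * (\<bar>a\<bar> powr s * t\<^sup>2)"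
      by (simp add: algebra_simps)
    also have "\<bar>a\<bar> powr s * t = sgn a * \<bar>a\<bar> powr (s - 1) * b"
    proof -
      have "\<bar>a\<bar> powr s = \<bar>a\<bar> powr (s - 1) * \<bar>a\<bar>"
        using False powr_add[of "\<bar>a\<bar>" "s - 1" 1] by simp
      then show ?thesis by (simp add: b abs_sgn)
    qed
    also have "\<bar>a\<bar> powr s * t\<^sup>2 = \<bar>a\<bar> powr (s - 2) * b\<^sup>2"
    proof -
      have "\<bar>a\<bar> powr s = \<bar>a\<bar> powr (s - 2) * \<bar>a\<bar>\<^sup>2"
        using False powr_add[of "\<bar>a\<bar>" "s - 2" 2] by simp
      then show ?thesis by (simp add: b power_mult_distrib)
    qed
    finally show ?thesis
      by (rule order_trans) simp
  qed
next
  case False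
  then have a: "\<bar>a\<bar> \<le> s * \<bar>b\<bar>" by simp
  then have "\<bar>a + b\<bar> \<le> (1 + s) * \<bar>b\<bar>" by (simp add: algebra_simps)
  then have "\<bar>a + b\<bar> powr s \<le> ((1 + s) * \<bar>b\<bar>) powr s"
    using s by (intro powr_mono2) auto
  then have 1: "\<bar>a + b\<bar> powr s \<le> (1 + s) powr s * \<bar>b\<bar> powr s"
    using s by (simp add: powr_mult)
  have "b \<noteq> 0" using False s by auto
  have "\<bar>sgn a * \<bar>a\<bar> powr (s - 1) * b\<bar> \<le> \<bar>a\<bar> powr (s - 1) * \<bar>b\<bar>"
    by (simp add: abs_mult abs_sgn_eq)
  also have "\<dots> \<le> (s * \<bar>b\<bar>) powr (s - 1) * \<bar>b\<bar>"
    using s a by (intro mult_right_mono powr_mono2) auto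
  also have "\<dots> = s powr (s - 1) * \<bar>b\<bar> powr s"
    using s \<open>b \<noteq> 0\<close> powr_add[of "\<bar>b\<bar>" "s - 1" 1] by (simp add: powr_mult)
  finally have "s * \<bar>sgn a * \<bar>a\<bar> powr (s - 1) * b\<bar> \<le> s * (s powr (s - 1) * \<bar>b\<bar> powr s)"
    using s by (intro mult_left_mono) auto
  also have "\<dots> = s powr s * \<bar>b\<bar> powr s"
    using s powr_add[of s "s - 1" 1] by simp
  finally have "- (s * (sgn a * \<bar>a\<bar> powr (s - 1) * b)) \<le> s powr s * \<bar>b\<bar> powr s"
    using s abs_le_D2[of "s * (sgn a * \<bar>a\<bar> powr (s - 1) * b)"] by (simp add: abs_mult)
  moreover have "0 \<le> \<bar>a\<bar> powr s" "0 \<le> s\<^sup>2 * (\<bar>a\<bar> powr (s - 2) * b\<^sup>2)" by auto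
  ultimately show ?thesis using 1 unfolding distrib_right by linarith
qed

text \<open>The first summand comes from the quadratic term of \<open>abs_powr_add_le\<close> in the
  range a^2 < 2 s^2 n b^2; the second is the coefficient of |b|^s there.\<close>

definition moment_const :: "real \<Rightarrow> real" where
  "moment_const s = s\<^sup>2 * (2 * s\<^sup>2) powr (s / 2 - 1) + ((1 + s) powr s + s powr s)"

lemma moment_const_nonneg: "0 \<le> moment_const s"
  by (simp add: moment_const_def)

text \<open>The weight \<open>1 + 1 / (2 * n)\<close> is chosen so that the bound \<open>n powr (s / 2)\<close> on the moments of
  partial sums propagates by induction: passing from \<open>n - 1\<close> to \<open>n\<close>, half of the growth of
  \<open>n powr (s / 2)\<close> absorbs this weight and half absorbs the term in \<open>b\<close>.\<close>

lemma abs_powr_add_le_step: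
  fixes a b s n :: real
  assumes s: "s \<ge> 2" and n: "n \<ge> 1"
  shows "\<bar>a + b\<bar> powr s \<le> (1 + 1 / (2 * n)) * \<bar>a\<bar> powr s + s * (sgn a * \<bar>a\<bar> powr (s - 1) * b)
    + moment_const s * n powr (s / 2 - 1) * \<bar>b\<bar> powr s"
proof -
  have sq: "(x\<^sup>2) powr (s / 2 - 1) = \<bar>x\<bar> powr (s - 2)" for x :: real
    using powr_powr[of "\<bar>x\<bar>" 2 "s / 2 - 1"] by (cases "x = 0") (auto simp: algebra_simps)
  have mul: "\<bar>x\<bar> powr (s - 2) * x\<^sup>2 = \<bar>x\<bar> powr s" for x :: real
    using powr_add[of "\<bar>x\<bar>" "s - 2" 2] by (cases "x = 0") auto
  have "s\<^sup>2 * (\<bar>a\<bar> powr (s - 2) * b\<^sup>2)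
      \<le> 1 / (2 * n) * \<bar>a\<bar> powr s + s\<^sup>2 * (2 * s\<^sup>2 * n) powr (s / 2 - 1) * \<bar>b\<bar> powr s"
  \<comment> \<open>The threshold is where s^2 b^2 equals a^2 / (2n). On one side the quadratic term
    fits into the extra weight 1 / (2n) of |a|^s; on the other |a|^(s-2) is replaced by a multiple
    of |b|^(s-2), at the price of n^(s/2-1).\<close>
  proof (cases "2 * s\<^sup>2 * n * b\<^sup>2 \<le> a\<^sup>2")
    case True
    then have "s\<^sup>2 * b\<^sup>2 \<le> 1 / (2 * n) * a\<^sup>2" using n by (simp add: field_simps)
    then have "\<bar>a\<bar> powr (s - 2) * (s\<^sup>2 * b\<^sup>2) \<le> \<bar>a\<bar> powr (s - 2) * (1 / (2 * n) * a\<^sup>2)"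
      by (intro mult_left_mono) auto
    also have "\<dots> = 1 / (2 * n) * \<bar>a\<bar> powr s" by (simp flip: mul)
    finally show ?thesis
      by (simp add: algebra_simps add_increasing2)
  next
    case False
    then have "(a\<^sup>2) powr (s / 2 - 1) \<le> (2 * s\<^sup>2 * n * b\<^sup>2) powr (s / 2 - 1)"
      using s by (intro powr_mono2) auto
    then have "\<bar>a\<bar> powr (s - 2) \<le> (2 * s\<^sup>2 * n) powr (s / 2 - 1) * \<bar>b\<bar> powr (s - 2)"
      using n by (simp add: powr_mult sq)
    then have "s\<^sup>2 * (\<bar>a\<bar> powr (s - 2) * b\<^sup>2)
        \<le> s\<^sup>2 * ((2 * s\<^sup>2 * n) powr (s / 2 - 1) * \<bar>b\<bar> powr (s - 2) * b\<^sup>2)"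
      by (intro mult_left_mono mult_right_mono) auto
    also have "\<dots> = s\<^sup>2 * (2 * s\<^sup>2 * n) powr (s / 2 - 1) * \<bar>b\<bar> powr s"
      by (simp add: mult.assoc mul)
    finally show ?thesis using n by (simp add: add_increasing)
  qed
  also have "(2 * s\<^sup>2 * n) powr (s / 2 - 1) = (2 * s\<^sup>2) powr (s / 2 - 1) * n powr (s / 2 - 1)"
    using n by (simp add: powr_mult)
  finally have 1: "s\<^sup>2 * (\<bar>a\<bar> powr (s - 2) * b\<^sup>2) \<le> 1 / (2 * n) * \<bar>a\<bar> powr s
      + s\<^sup>2 * (2 * s\<^sup>2) powr (s / 2 - 1) * n powr (s / 2 - 1) * \<bar>b\<bar> powr s"
    by (simp add: mult.assoc)
  have "1 \<le> n powr (s / 2 - 1)" using n s by (intro ge_one_powr_ge_zero) auto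
  then have "((1 + s) powr s + s powr s) * 1 * \<bar>b\<bar> powr s
      \<le> ((1 + s) powr s + s powr s) * n powr (s / 2 - 1) * \<bar>b\<bar> powr s"
    by (intro mult_right_mono mult_left_mono) auto
  with 1 abs_powr_add_le[OF s, of a b] show ?thesis
    by (simp add: moment_const_def algebra_simps)
qed

lemma abs_powr_add_le_two:
  fixes a b s :: real
  assumes "s \<ge> 0"
  shows "\<bar>a + b\<bar> powr s \<le> 2 powr s * (\<bar>a\<bar> powr s + \<bar>b\<bar> powr s)"
proof -
  have "\<bar>a + b\<bar> powr s \<le> (2 * max \<bar>a\<bar> \<bar>b\<bar>) powr s"
    using assms by (intro powr_mono2) auto
  also have "\<dots> = 2 powr s * max \<bar>a\<bar> \<bar>b\<bar> powr s" by (simp add: powr_mult)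
  also have "\<dots> \<le> 2 powr s * (\<bar>a\<bar> powr s + \<bar>b\<bar> powr s)"
    by (intro mult_left_mono) (auto simp: max_def)
  finally show ?thesis .
qed

lemma convex_on_abs_powr:
  fixes s :: real
  assumes "s \<ge> 1"
  shows "convex_on UNIV (\<lambda>x::real. \<bar>x\<bar> powr s)"
proof (rule convex_onI)
  fix t x y :: real
  assume t: "0 < t" "t < 1"
  have "\<bar>(1 - t) * x + t * y\<bar> \<le> (1 - t) * \<bar>x\<bar> + t * \<bar>y\<bar>"
    using t abs_triangle_ineq[of "(1 - t) * x" "t * y"] by (simp add: abs_mult)
  then have "\<bar>(1 - t) * x + t * y\<bar> powr s \<le> ((1 - t) * \<bar>x\<bar> + t * \<bar>y\<bar>) powr s"
    using assms by (intro powr_mono2) auto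
  also have "\<dots> \<le> (1 - t) * \<bar>x\<bar> powr s + t * \<bar>y\<bar> powr s"
  proof -
    \<comment> \<open>This settles the cases in which \<open>x\<close> or \<open>y\<close> is 0:
      there the claim reduces to u^s \<le> u for 0 < u < 1.\<close>
    have *: "(u * z) powr s \<le> u * z powr s" if "0 < u" "u < 1" "0 \<le> z" for u z :: real
      using that assms powr_mono'[of 1 s u] by (auto simp: powr_mult intro: mult_right_mono)
    consider "x = 0" | "y = 0" | "x \<noteq> 0" "y \<noteq> 0" by blast
    then show ?thesis
    proof cases
      case 3
      then show ?thesis
        using convex_onD[OF powr_convex[OF assms], of t "\<bar>x\<bar>" "\<bar>y\<bar>"] t by simp
    qed (use *[of t "\<bar>y\<bar>"] *[of "1 - t" "\<bar>x\<bar>"] t in auto)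
  qed
  finally show "\<bar>(1 - t) *\<^sub>R x + t *\<^sub>R y\<bar> powr s \<le> (1 - t) * \<bar>x\<bar> powr s + t * \<bar>y\<bar> powr s"
    by simp
qed auto

section \<open>Cauchy condensation along roots\<close>

lemma summable_of_summable_mult:
  fixes h :: "nat \<Rightarrow> real"
  assumes "decseq h" "\<And>k. h k \<ge> 0" "N > 0" "summable (\<lambda>m. h (N * m))"
  shows "summable h"
proof (rule summableI_nonneg_bounded)
  fix n
  have "(\<Sum>k<n. h k) \<le> (\<Sum>k<n * N. h k)"
    using assms by (intro sum_mono2) auto
  also have "\<dots> = (\<Sum>m<n. sum h {m * N..<m * N + N})"
    by (rule sum.nat_group[symmetric])
  \<comment> \<open>By monotonicity each block of \<open>N\<close> consecutive terms is at most
    \<open>N\<close> times its first term.\<close>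
  also have "\<dots> \<le> (\<Sum>m<n. \<Sum>k\<in>{m * N..<m * N + N}. h (N * m))"
    using assms(1) by (intro sum_mono) (auto simp: decseq_def mult.commute)
  also have "\<dots> = real N * (\<Sum>m<n. h (N * m))" by (simp add: sum_distrib_left)
  also have "\<dots> \<le> real N * (\<Sum>m. h (N * m))"
    using assms by (intro mult_left_mono sum_le_suminf) auto
  finally show "(\<Sum>k<n. h k) \<le> real N * (\<Sum>m. h (N * m))" .
qed (use assms in auto)

text \<open>Condensation leads to the terms 1 / f(2^(k/N)). They decrease in \<open>k\<close>, and
  at the multiples k = N m they are the given 1 / f(2^m), so
  \<open>summable_of_summable_mult\<close> applies.\<close>

lemma summable_root_condensation:
  fixes f :: "real \<Rightarrow> real"
  assumes pos: "\<And>x. x \<ge> 0 \<Longrightarrow> f x > 0" and mono: "mono_on {0..} f"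
    and sum: "summable (\<lambda>n. 1 / f (2 ^ Suc n))" and N: "N > 0"
  shows "summable (\<lambda>n. 1 / (real n * f (real n powr (1 / real N))))"
proof -
  have le: "f x \<le> f y" if "0 \<le> x" "x \<le> y" for x y
    using mono that by (auto simp: mono_on_def)
  have "summable (\<lambda>n. 1 / (real n * f (real n powr (1 / real N))))
    \<longleftrightarrow> summable (\<lambda>k. 2 ^ k * (1 / (real (2 ^ k) * f (real (2 ^ k) powr (1 / real N)))))"
  proof (rule condensation_test)
    show "1 / (real (Suc m) * f (real (Suc m) powr (1 / real N)))
        \<le> 1 / (real m * f (real m powr (1 / real N)))" if "0 < m" for m
      using that pos by (intro divide_left_mono mult_mono le powr_mono2 mult_pos_pos) (auto simp: less_imp_le)
    show "0 \<le> 1 / (real m * f (real m powr (1 / real N)))" for m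
      using pos by (auto simp: less_imp_le)
  qed
  also have "(\<lambda>k. 2 ^ k * (1 / (real (2 ^ k) * f (real (2 ^ k) powr (1 / real N)))))
      = (\<lambda>k. 1 / f (2 powr (real k / real N)))"
    by (simp add: powr_powr powr_realpow[symmetric])
  also have "summable \<dots>"
  proof (rule summable_of_summable_mult[OF _ _ N])
    show "decseq (\<lambda>k. 1 / f (2 powr (real k / real N)))"
      using pos N by (intro decseq_SucI divide_left_mono le powr_mono mult_pos_pos) (auto intro!: divide_right_mono)
    have "(\<lambda>m. 1 / f (2 powr (real (N * m) / real N))) = (\<lambda>m. 1 / f (2 ^ m))"
      using N by (simp add: powr_realpow)
    moreover have "summable (\<lambda>m. 1 / f (2 ^ m))" using sum by (subst (asm) summable_Suc_iff)
    ultimately show "summable (\<lambda>m. 1 / f (2 powr (real (N * m) / real N)))" by simp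
  qed (use pos in \<open>auto simp: less_imp_le\<close>)
  finally show ?thesis .
qed

section \<open>Moments of martingale differences and centred sequences\<close>

locale filtered_prob_space = prob_space M for M :: "'a measure" +
  fixes F :: "nat \<Rightarrow> 'a measure"
  assumes subalgebra_F: "subalgebra M (F n)"
    and sets_F_mono: "i \<le> j \<Longrightarrow> sets (F i) \<subseteq> sets (F j)"
begin

lemma sigma_finite_subalgebra_F: "sigma_finite_subalgebra M (F n)"
  by (intro finite_measure_subalgebra_is_sigma_finite finite_measure_subalgebra.intro
      finite_measure_subalgebra_axioms.intro subalgebra_F finite_measure_axioms)

lemma borel_measurable_F_M: "g \<in> borel_measurable (F n) \<Longrightarrow> g \<in> borel_measurable M"
  by (rule measurable_from_subalg[OF subalgebra_F])

lemma borel_measurable_F_mono: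
  assumes "i \<le> j" "g \<in> borel_measurable (F i)"
  shows "g \<in> borel_measurable (F j)"
proof (rule measurable_from_subalg[OF _ assms(2)])
  show "subalgebra (F j) (F i)"
    using sets_F_mono[OF assms(1)] subalgebra_F by (auto simp: subalgebra_def)
qed

text \<open>Fixing the filtration allows the stopped and truncated sequences below to be martingale
  differences for the filtration of the original sequence.\<close>

definition mds :: "(nat \<Rightarrow> 'a \<Rightarrow> real) \<Rightarrow> bool" where
  "mds Y \<longleftrightarrow> (\<forall>n\<ge>1. integrable M (Y n) \<and> Y n \<in> borel_measurable (F n) \<and>
     (AE \<omega> in M. real_cond_exp M (F (n - 1)) (Y n) \<omega> = 0))"

lemma partial_sum_measurable:
  assumes "\<And>i. i \<ge> 1 \<Longrightarrow> Y i \<in> borel_measurable (F i)"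
  shows "partial_sum Y n \<in> borel_measurable (F n)"
  unfolding partial_sum_def[abs_def]
  by (intro borel_measurable_sum borel_measurable_F_mono[OF _ assms]) auto

text \<open>Removes the first-order term of \<open>abs_powr_add_le_step\<close> from the moment
  estimate below, with \<open>g\<close> the derivative of |.|^s at the preceding partial sum, up to
  the factor \<open>s\<close>.\<close>

lemma mds_orthogonal:
  assumes Y: "mds Y" and n: "n \<ge> 1" and g: "g \<in> borel_measurable (F (n - 1))"
    and int: "integrable M (\<lambda>x. g x * Y n x)"
  shows "(\<integral>x. g x * Y n x \<partial>M) = 0"
proof -
  interpret sigma_finite_subalgebra M "F (n - 1)" by (rule sigma_finite_subalgebra_F)
  have "Y n \<in> borel_measurable M"
    using Y n borel_measurable_F_M[of "Y n" n] by (auto simp: mds_def)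
  note real_cond_exp_intg(2)[OF int g this, symmetric]
  also have "(\<integral>x. g x * real_cond_exp M (F (n - 1)) (Y n) x \<partial>M) = (\<integral>x. 0 \<partial>M)"
    using Y n borel_measurable_F_M[OF g] borel_measurable_F_M[OF borel_measurable_cond_exp]
    by (intro integral_cong_AE) (auto simp: mds_def)
  finally show ?thesis by simp
qed

text \<open>Induction on \<open>n\<close>: \<open>abs_powr_add_le_step\<close> is applied to the old
  sum and the new difference and then integrated. Integrability is part of the induction, since it
  is needed before the first-order term can be integrated to 0.\<close>

lemma mds_moment_bound:
  assumes Y: "mds Y" and s: "s \<ge> 2"
    and int: "\<And>i. i \<ge> 1 \<Longrightarrow> integrable M (\<lambda>x. \<bar>Y i x\<bar> powr s)"
    and L: "\<And>i. i \<ge> 1 \<Longrightarrow> (\<integral>x. \<bar>Y i x\<bar> powr s \<partial>M) \<le> L"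
  shows "integrable M (\<lambda>x. \<bar>partial_sum Y n x\<bar> powr s) \<and>
    (\<integral>x. \<bar>partial_sum Y n x\<bar> powr s \<partial>M) \<le> 2 * moment_const s * real n powr (s / 2) * L"
proof (induction n)
  case 0
  then show ?case by (simp add: partial_sum_def)
next
  case (Suc n)
  let ?S = "partial_sum Y n" and ?Y = "Y (Suc n)" and ?D = "moment_const s"
  define N where "N = real (Suc n)"
  have N: "N \<ge> 1" by (simp add: N_def)
  have Ym: "\<And>i. i \<ge> 1 \<Longrightarrow> Y i \<in> borel_measurable (F i)" using Y by (auto simp: mds_def)
  note SF = partial_sum_measurable[OF Ym]
  note [measurable] = borel_measurable_F_M[OF Ym[of "Suc n", simplified]] borel_measurable_F_M[OF SF[of n]]
  have S_Suc: "partial_sum Y (Suc n) x = ?S x + ?Y x" for x by (simp add: partial_sum_def)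
  have intS: "integrable M (\<lambda>x. \<bar>?S x\<bar> powr s)" using Suc by simp
  have intY: "integrable M (\<lambda>x. \<bar>?Y x\<bar> powr s)" by (rule int) simp
  have LY: "(\<integral>x. \<bar>?Y x\<bar> powr s \<partial>M) \<le> L" by (rule L) simp
  have "0 \<le> (\<integral>x. \<bar>?Y x\<bar> powr s \<partial>M)" by simp
  with LY have "0 \<le> L" by linarith
  let ?g = "\<lambda>x. sgn (?S x) * \<bar>?S x\<bar> powr (s - 1)"
  have intg: "integrable M (\<lambda>x. ?g x * ?Y x)"
  proof (rule Bochner_Integration.integrable_bound)
    show "integrable M (\<lambda>x. \<bar>?S x\<bar> powr s + \<bar>?Y x\<bar> powr s)" using intS intY by simp
    show "AE x in M. norm (?g x * ?Y x) \<le> norm (\<bar>?S x\<bar> powr s + \<bar>?Y x\<bar> powr s)"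
    proof (rule AE_I2)
      fix x
      have mul: "m powr (s - 1) * m = m powr s" if "m \<ge> 0" for m :: real
        using powr_add[of m "s - 1" 1] that by (cases "m = 0") auto
      \<comment> \<open>Bounding both factors by the larger of |S| and |Y| replaces an appeal to
        Young's inequality.\<close>
      define m where "m = max \<bar>?S x\<bar> \<bar>?Y x\<bar>"
      have "norm (?g x * ?Y x) \<le> \<bar>?S x\<bar> powr (s - 1) * \<bar>?Y x\<bar>"
        by (simp add: abs_mult abs_sgn_eq)
      also have "\<dots> \<le> m powr (s - 1) * m"
        using s by (intro mult_mono powr_mono2) (auto simp: m_def)
      also have "\<dots> = m powr s" by (rule mul) (simp add: m_def)
      also have "\<dots> \<le> \<bar>?S x\<bar> powr s + \<bar>?Y x\<bar> powr s" by (auto simp: m_def max_def)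
      finally show "norm (?g x * ?Y x) \<le> norm (\<bar>?S x\<bar> powr s + \<bar>?Y x\<bar> powr s)" by simp
    qed
  qed simp
  have g0: "(\<integral>x. ?g x * ?Y x \<partial>M) = 0"
    using mds_orthogonal[OF Y, of "Suc n" ?g] intg SF[of n] by simp
  let ?R = "\<lambda>x. (1 + 1 / (2 * N)) * \<bar>?S x\<bar> powr s + s * (?g x * ?Y x)
      + ?D * N powr (s / 2 - 1) * \<bar>?Y x\<bar> powr s"
  have intR: "integrable M ?R" using intS intY intg by simp
  have le: "\<bar>partial_sum Y (Suc n) x\<bar> powr s \<le> ?R x" for x
    unfolding S_Suc using abs_powr_add_le_step[OF s N, of "?S x" "?Y x"] by simp
  have int': "integrable M (\<lambda>x. \<bar>partial_sum Y (Suc n) x\<bar> powr s)"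
  proof (rule Bochner_Integration.integrable_bound[OF intR])
    show "AE x in M. norm (\<bar>partial_sum Y (Suc n) x\<bar> powr s) \<le> norm (?R x)"
      using le by (auto intro: order_trans[OF _ abs_ge_self])
  qed (simp add: S_Suc)
  have "(\<integral>x. \<bar>partial_sum Y (Suc n) x\<bar> powr s \<partial>M) \<le> (\<integral>x. ?R x \<partial>M)"
    by (intro integral_mono int' intR le)
  also have "\<dots> = (1 + 1 / (2 * N)) * (\<integral>x. \<bar>?S x\<bar> powr s \<partial>M)
      + ?D * N powr (s / 2 - 1) * (\<integral>x. \<bar>?Y x\<bar> powr s \<partial>M)"
    using intS intY intg g0 by simp
  also have "\<dots> \<le> (1 + 1 / (2 * N)) * (2 * ?D * (N powr (s / 2) * (1 - 1 / N)) * L)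
      + ?D * N powr (s / 2 - 1) * L"
  proof (intro add_mono mult_left_mono LY)
    \<comment> \<open>As s/2 \<ge> 1, the ratio (n/N)^(s/2) = (1 - 1/N)^(s/2) is at most 1 -
      1/N.\<close>
    have "real n powr (s / 2) \<le> N powr (s / 2) * (1 - 1 / N)"
    proof -
      have "real n = N * (1 - 1 / N)" using N by (simp add: N_def field_simps)
      then have "real n powr (s / 2) = N powr (s / 2) * (1 - 1 / N) powr (s / 2)"
        using N by (simp add: powr_mult)
      also have "\<dots> \<le> N powr (s / 2) * (1 - 1 / N) powr 1"
        using N s by (intro mult_left_mono powr_mono') auto
      finally show ?thesis using N by simp
    qed
    then have "2 * ?D * real n powr (s / 2) * L \<le> 2 * ?D * (N powr (s / 2) * (1 - 1 / N)) * L"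
      using \<open>0 \<le> L\<close> moment_const_nonneg[of s] by (intro mult_left_mono mult_right_mono) auto
    then show "(\<integral>x. \<bar>?S x\<bar> powr s \<partial>M) \<le> 2 * ?D * (N powr (s / 2) * (1 - 1 / N)) * L"
      using Suc by simp
  qed (use N moment_const_nonneg in auto)
  \<comment> \<open>Thanks to the factor 2 in the claim, the new difference costs only the fraction
    1/(2N) of the target. Together with the weight 1 + 1/(2N) it is offset by the loss 1/N: the last
    bracket equals 1 - 1/(2 N^2).\<close>
  also have "\<dots> = 2 * ?D * N powr (s / 2) * L * ((1 + 1 / (2 * N)) * (1 - 1 / N) + 1 / (2 * N))"
  proof -
    have "N powr (s / 2 - 1) = N powr (s / 2) / N" using N by (simp add: powr_diff)
    then show ?thesis using N by (simp add: field_simps)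
  qed
  also have "\<dots> \<le> 2 * ?D * N powr (s / 2) * L * 1"
  proof (rule mult_left_mono)
    show "(1 + 1 / (2 * N)) * (1 - 1 / N) + 1 / (2 * N) \<le> 1"
      using N by (simp add: field_simps)
  qed (use \<open>0 \<le> L\<close> moment_const_nonneg[of s] in auto)
  finally show ?case using int' by (simp add: N_def)
qed

text \<open>Conditional Jensen bounds |E(Y | F_n)|^s by E(|Y|^s | F_n), which has the same integral
  as |Y|^s. Splitting the difference costs 2^s, and the two equal integrals give one more factor
  2.\<close>

lemma centred_moment_bound:
  assumes s: "s \<ge> 1" and Y: "integrable M Y" and int: "integrable M (\<lambda>x. \<bar>Y x\<bar> powr s)"
  shows "integrable M (\<lambda>x. \<bar>Y x - real_cond_exp M (F n) Y x\<bar> powr s)"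
    and "(\<integral>x. \<bar>Y x - real_cond_exp M (F n) Y x\<bar> powr s \<partial>M)
      \<le> 2 powr (s + 1) * (\<integral>x. \<bar>Y x\<bar> powr s \<partial>M)"
proof -
  interpret F: sigma_finite_subalgebra M "F n" by (rule sigma_finite_subalgebra_F)
  let ?E = "real_cond_exp M (F n) Y" and ?J = "real_cond_exp M (F n) (\<lambda>x. \<bar>Y x\<bar> powr s)"
  have [measurable]: "Y \<in> borel_measurable M" using Y by auto
  have J: "integrable M ?J" "(\<integral>x. ?J x \<partial>M) = (\<integral>x. \<bar>Y x\<bar> powr s \<partial>M)"
    using F.real_cond_exp_int[OF int] by auto
  have "AE x in M. \<bar>?E x\<bar> powr s \<le> ?J x"
    using F.real_cond_exp_jensens_inequality(2)[of Y UNIV _ _ "\<lambda>x. \<bar>x\<bar> powr s"] Y int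
      convex_on_abs_powr[OF s] by simp
  then have le: "AE x in M. \<bar>Y x - ?E x\<bar> powr s \<le> 2 powr s * (\<bar>Y x\<bar> powr s + ?J x)"
  proof eventually_elim
    case (elim x)
    have "\<bar>Y x - ?E x\<bar> powr s \<le> 2 powr s * (\<bar>Y x\<bar> powr s + \<bar>?E x\<bar> powr s)"
      using abs_powr_add_le_two[of s "Y x" "- ?E x"] s by simp
    also have "\<dots> \<le> 2 powr s * (\<bar>Y x\<bar> powr s + ?J x)" using elim by simp
    finally show ?case .
  qed
  have intR: "integrable M (\<lambda>x. 2 powr s * (\<bar>Y x\<bar> powr s + ?J x))" using int J by simp
  show int': "integrable M (\<lambda>x. \<bar>Y x - ?E x\<bar> powr s)"
    by (rule Bochner_Integration.integrable_bound[OF intR])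
      (use le in \<open>auto elim!: eventually_mono intro: order_trans[OF _ abs_ge_self]\<close>)
  have "(\<integral>x. \<bar>Y x - ?E x\<bar> powr s \<partial>M) \<le> (\<integral>x. 2 powr s * (\<bar>Y x\<bar> powr s + ?J x) \<partial>M)"
    by (rule integral_mono_AE[OF int' intR le])
  also have "\<dots> = 2 powr (s + 1) * (\<integral>x. \<bar>Y x\<bar> powr s \<partial>M)"
    using int J by (simp add: powr_add)
  finally show "(\<integral>x. \<bar>Y x - ?E x\<bar> powr s \<partial>M) \<le> 2 powr (s + 1) * (\<integral>x. \<bar>Y x\<bar> powr s \<partial>M)" .
qed

definition centred :: "(nat \<Rightarrow> 'a \<Rightarrow> real) \<Rightarrow> nat \<Rightarrow> 'a \<Rightarrow> real" where
  "centred Y i x = Y i x - real_cond_exp M (F (i - 1)) (Y i) x"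

text \<open>Centring makes the conditional mean 0, and a bounded factor already known at time
  \<open>i - 1\<close> comes out of the conditional expectation. The factor will be the indicator
  that the walk has not yet been stopped.\<close>

lemma mds_predictable_mult_centred:
  assumes Y: "\<And>i. i \<ge> 1 \<Longrightarrow> integrable M (Y i)" "\<And>i. i \<ge> 1 \<Longrightarrow> Y i \<in> borel_measurable (F i)"
    and H: "\<And>i. i \<ge> 1 \<Longrightarrow> H i \<in> borel_measurable (F (i - 1))" "\<And>i x. \<bar>H i x\<bar> \<le> (1 :: real)"
  shows "mds (\<lambda>i x. H i x * centred Y i x)"
  unfolding mds_def
proof (intro allI impI conjI)
  fix i :: nat assume i: "i \<ge> 1"
  interpret F: sigma_finite_subalgebra M "F (i - 1)" by (rule sigma_finite_subalgebra_F)
  have HM: "H i \<in> borel_measurable M" using borel_measurable_F_M H(1)[OF i] .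
  have intC: "integrable M (centred Y i)"
    unfolding centred_def[abs_def] using F.real_cond_exp_int[OF Y(1)[OF i]] Y(1)[OF i] by simp
  show int: "integrable M (\<lambda>x. H i x * centred Y i x)"
    by (rule Bochner_Integration.integrable_bound[OF intC])
      (use HM intC H(2) in \<open>auto simp: abs_mult intro!: mult_left_le_one_le\<close>)
  have "H i \<in> borel_measurable (F i)" "real_cond_exp M (F (i - 1)) (Y i) \<in> borel_measurable (F i)"
    by (rule borel_measurable_F_mono[of "i - 1"]; use H(1)[OF i] in simp)+
  then show "(\<lambda>x. H i x * centred Y i x) \<in> borel_measurable (F i)"
    using Y(2)[OF i] unfolding centred_def by auto
  let ?E = "real_cond_exp M (F (i - 1)) (Y i)"
  have "AE x in M. real_cond_exp M (F (i - 1)) (centred Y i) x = ?E x - real_cond_exp M (F (i - 1)) ?E x"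
    unfolding centred_def[abs_def]
    using F.real_cond_exp_diff[of "Y i" ?E] F.real_cond_exp_int[OF Y(1)[OF i]] Y(1)[OF i] by simp
  moreover have "AE x in M. real_cond_exp M (F (i - 1)) ?E x = ?E x"
    using F.real_cond_exp_int[OF Y(1)[OF i]] by (intro F.real_cond_exp_F_meas) auto
  moreover have "AE x in M. real_cond_exp M (F (i - 1)) (\<lambda>x. H i x * centred Y i x) x
      = H i x * real_cond_exp M (F (i - 1)) (centred Y i) x"
    using H(1)[OF i] intC int by (intro F.real_cond_exp_mult) auto
  ultimately show "AE x in M. real_cond_exp M (F (i - 1)) (\<lambda>x. H i x * centred Y i x) x = 0"
    by eventually_elim simp
qed

text \<open>Markov's inequality for the s-th power. Since |H| \<le> 1 the multipliers only shrink
  moments; centring contributes 2^(s+1) and \<open>mds_moment_bound\<close> another 2.\<close>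

lemma prob_partial_sum_centred_ge:
  assumes s: "s \<ge> 2" and Y: "\<And>i. i \<ge> 1 \<Longrightarrow> integrable M (Y i)" "\<And>i. i \<ge> 1 \<Longrightarrow> Y i \<in> borel_measurable (F i)"
    and int: "\<And>i. i \<ge> 1 \<Longrightarrow> integrable M (\<lambda>x. \<bar>Y i x\<bar> powr s)"
    and L: "\<And>i. i \<ge> 1 \<Longrightarrow> (\<integral>x. \<bar>Y i x\<bar> powr s \<partial>M) \<le> L"
    and H: "\<And>i. i \<ge> 1 \<Longrightarrow> H i \<in> borel_measurable (F (i - 1))" "\<And>i x. \<bar>H i x\<bar> \<le> (1 :: real)"
    and c: "c > 0"
  shows "prob {x \<in> space M. \<bar>partial_sum (\<lambda>i x. H i x * centred Y i x) n x\<bar> \<ge> c}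
    \<le> moment_const s * 2 powr (s + 2) * real n powr (s / 2) * L / c powr s"
proof -
  let ?Z = "\<lambda>i x. H i x * centred Y i x"
  let ?T = "partial_sum ?Z n"
  have Z: "mds ?Z" using mds_predictable_mult_centred Y H by blast
  have pow: "\<bar>?Z i x\<bar> powr s \<le> \<bar>centred Y i x\<bar> powr s" for i x
    using H(2)[of i x] s by (intro powr_mono2) (auto simp: abs_mult intro!: mult_left_le_one_le)
  have intC: "integrable M (\<lambda>x. \<bar>centred Y i x\<bar> powr s)"
    and LC: "(\<integral>x. \<bar>centred Y i x\<bar> powr s \<partial>M) \<le> 2 powr (s + 1) * L" if "i \<ge> 1" for i
  proof -
    show "integrable M (\<lambda>x. \<bar>centred Y i x\<bar> powr s)"
      unfolding centred_def by (rule centred_moment_bound) (use s Y int that in auto)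
    have "(\<integral>x. \<bar>centred Y i x\<bar> powr s \<partial>M) \<le> 2 powr (s + 1) * (\<integral>x. \<bar>Y i x\<bar> powr s \<partial>M)"
      unfolding centred_def by (rule centred_moment_bound) (use s Y int that in auto)
    also have "\<dots> \<le> 2 powr (s + 1) * L" by (intro mult_left_mono L that) auto
    finally show "(\<integral>x. \<bar>centred Y i x\<bar> powr s \<partial>M) \<le> 2 powr (s + 1) * L" .
  qed
  have intZ: "integrable M (\<lambda>x. \<bar>?Z i x\<bar> powr s)" if "i \<ge> 1" for i
  proof (rule Bochner_Integration.integrable_bound[OF intC[OF that]])
    have [measurable]: "?Z i \<in> borel_measurable M"
      using Z that by (auto simp: mds_def)
    show "(\<lambda>x. \<bar>?Z i x\<bar> powr s) \<in> borel_measurable M" by measurable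
  qed (use pow in auto)
  have LZ: "(\<integral>x. \<bar>?Z i x\<bar> powr s \<partial>M) \<le> 2 powr (s + 1) * L" if "i \<ge> 1" for i
    using integral_mono[OF intZ[OF that] intC[OF that] pow] LC[OF that] by linarith
  have bound: "integrable M (\<lambda>x. \<bar>?T x\<bar> powr s)"
    "(\<integral>x. \<bar>?T x\<bar> powr s \<partial>M) \<le> 2 * moment_const s * real n powr (s / 2) * (2 powr (s + 1) * L)"
    using mds_moment_bound[OF Z s intZ LZ] by auto
  have "\<bar>?T x\<bar> \<ge> c \<longleftrightarrow> \<bar>?T x\<bar> powr s \<ge> c powr s" for x
    using c s powr_mono2[of s c "\<bar>?T x\<bar>"] powr_less_mono2[of s "\<bar>?T x\<bar>" c]
    by linarith
  then have "{x \<in> space M. \<bar>?T x\<bar> \<ge> c} = {x \<in> space M. \<bar>?T x\<bar> powr s \<ge> c powr s}"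
    by blast
  also have "prob \<dots> \<le> (\<integral>x. \<bar>?T x\<bar> powr s \<partial>M) / c powr s"
    using c by (intro integral_Markov_inequality_measure[of _ _ "{}"] bound) auto
  also have "\<dots> \<le> 2 * moment_const s * real n powr (s / 2) * (2 powr (s + 1) * L) / c powr s"
    by (intro divide_right_mono bound) auto
  also have "\<dots> = moment_const s * 2 powr (s + 2) * real n powr (s / 2) * L / c powr s"
    by (simp add: powr_add)
  finally show ?thesis .
qed

section \<open>Stopping at the first passage, and truncation\<close>

definition before_passage :: "(nat \<Rightarrow> 'a \<Rightarrow> real) \<Rightarrow> real \<Rightarrow> nat \<Rightarrow> 'a \<Rightarrow> real" where
  "before_passage X c i x = (if \<forall>j\<in>{1..<i}. \<bar>partial_sum X j x\<bar> \<le> c then 1 else 0)"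

text \<open>Only partial sums of index below \<open>i\<close> enter, so this indicator is
  predictable and may serve as the multiplier \<open>H\<close>.\<close>

lemma before_passage_measurable:
  assumes "\<And>i. i \<ge> 1 \<Longrightarrow> X i \<in> borel_measurable (F i)"
  shows "before_passage X c i \<in> borel_measurable (F (i - 1))"
proof -
  have [measurable]: "partial_sum X j \<in> borel_measurable (F (i - 1))" if "j \<in> {1..<i}" for j
    using borel_measurable_F_mono[OF _ partial_sum_measurable[OF assms], of j "i - 1"] that by auto
  show ?thesis unfolding before_passage_def[abs_def] by measurable
qed

text \<open>At the first index \<open>k\<close> with |S_k| > c the multipliers switch from 1 to 0
  after the k-th term, so the stopped sum is exactly S_k.\<close>

lemma stopped_partial_sum_gt:
  assumes n: "n \<ge> 1" and max: "max_partial_sum X n x > c"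
  shows "\<bar>\<Sum>i = 1..n. before_passage X c i x * X i x\<bar> > c"
proof -
  have "\<exists>j. j \<in> {1..n} \<and> \<bar>partial_sum X j x\<bar> > c"
    using max n unfolding max_partial_sum_def by (subst (asm) Max_gr_iff) auto
  then obtain k where k: "k \<in> {1..n}" "\<bar>partial_sum X k x\<bar> > c"
    and least: "\<And>j. j < k \<Longrightarrow> \<not> (j \<in> {1..n} \<and> \<bar>partial_sum X j x\<bar> > c)"
    using exists_least_iff[of "\<lambda>j. j \<in> {1..n} \<and> \<bar>partial_sum X j x\<bar> > c"] by blast
  have "before_passage X c i x = (if i \<le> k then 1 else 0)" for i
  proof (cases "i \<le> k")
    case True
    then have "\<bar>partial_sum X j x\<bar> \<le> c" if "j \<in> {1..<i}" for j
      using k least[of j] that by auto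
    with True show ?thesis by (simp add: before_passage_def)
  next
    case False
    then have "k \<in> {1..<i}" using k by simp
    with k show ?thesis by (auto simp: before_passage_def not_le)
  qed
  then have "(\<Sum>i = 1..n. before_passage X c i x * X i x) = (\<Sum>i = 1..n. if i \<in> {1..k} then X i x else 0)"
    by (intro sum.cong) auto
  also have "\<dots> = (\<Sum>i \<in> {1..n} \<inter> {1..k}. X i x)" by (rule sum.inter_restrict[symmetric]) simp
  also have "{1..n} \<inter> {1..k} = {1..k}" using k by auto
  finally show ?thesis using k by (simp add: partial_sum_def)
qed

text \<open>If the stopped sum exceeds \<open>c\<close>, the small or the large part has a stopped
  sum of size at least c/2. The two parts are estimated separately so that each may use its own
  moment exponent.\<close>

lemma prob_max_partial_sum_gt:
  assumes X: "mds X" and s: "s \<ge> 2" and q: "q \<ge> 2" and n: "n \<ge> 1" and c: "c > 0"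
    and small: "\<And>i. i \<ge> 1 \<Longrightarrow> integrable M (\<lambda>x. \<bar>if \<bar>X i x\<bar> \<le> b then X i x else 0\<bar> powr s)"
      "\<And>i. i \<ge> 1 \<Longrightarrow> (\<integral>x. \<bar>if \<bar>X i x\<bar> \<le> b then X i x else 0\<bar> powr s \<partial>M) \<le> L"
    and large: "\<And>i. i \<ge> 1 \<Longrightarrow> integrable M (\<lambda>x. \<bar>if \<bar>X i x\<bar> \<le> b then 0 else X i x\<bar> powr q)"
      "\<And>i. i \<ge> 1 \<Longrightarrow> (\<integral>x. \<bar>if \<bar>X i x\<bar> \<le> b then 0 else X i x\<bar> powr q \<partial>M) \<le> K"
  shows "prob {x \<in> space M. max_partial_sum X n x > c}
    \<le> moment_const s * 2 powr (s + 2) * real n powr (s / 2) * L / (c / 2) powr s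
      + moment_const q * 2 powr (q + 2) * real n powr (q / 2) * K / (c / 2) powr q"
proof -
  let ?U = "\<lambda>i x. if \<bar>X i x\<bar> \<le> b then X i x else 0"
  let ?V = "\<lambda>i x. if \<bar>X i x\<bar> \<le> b then 0 else X i x"
  let ?H = "before_passage X c"
  let ?SU = "partial_sum (\<lambda>i x. ?H i x * centred ?U i x) n"
  let ?SV = "partial_sum (\<lambda>i x. ?H i x * centred ?V i x) n"
  have XF: "X i \<in> borel_measurable (F i)" and Xint: "integrable M (X i)" if "i \<ge> 1" for i
    using X that by (auto simp: mds_def)
  have U: "integrable M (?U i)" and UF: "?U i \<in> borel_measurable (F i)" 
    and V: "integrable M (?V i)" and VF: "?V i \<in> borel_measurable (F i)" if "i \<ge> 1" for i
  proof -
    have [measurable]: "X i \<in> borel_measurable (F i)" "X i \<in> borel_measurable M"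
      using XF[OF that] Xint[OF that] by auto
    show "?U i \<in> borel_measurable (F i)" "?V i \<in> borel_measurable (F i)" by measurable
    show "integrable M (?U i)" "integrable M (?V i)"
      by (auto intro!: Bochner_Integration.integrable_bound[OF Xint[OF that]])
  qed
  note H = before_passage_measurable[of X, OF XF]
  have H1: "\<bar>?H i x\<bar> \<le> 1" for i x by (simp add: before_passage_def)
  have mds_m: "partial_sum Z n \<in> borel_measurable M" if "mds Z" for Z
    using borel_measurable_F_M[OF partial_sum_measurable[of Z n]] that by (auto simp: mds_def)
  have [measurable]: "?SU \<in> borel_measurable M" "?SV \<in> borel_measurable M"
    using U UF V VF H H1 by (intro mds_m mds_predictable_mult_centred; simp)+
  \<comment> \<open>Centring both parts does not change their sum: the two conditional expectations
    add up to that of \<open>X i\<close>, which is 0 almost everywhere.\<close>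
  have eq: "AE x in M. \<forall>i\<in>{1..n}. X i x = centred ?U i x + centred ?V i x"
  proof (rule AE_finite_allI)
    fix i assume "i \<in> {1..n}"
    then have i: "i \<ge> 1" by simp
    interpret F: sigma_finite_subalgebra M "F (i - 1)" by (rule sigma_finite_subalgebra_F)
    have "(\<lambda>x. ?U i x + ?V i x) = X i" by auto
    then have "AE x in M. real_cond_exp M (F (i - 1)) (X i) x
        = real_cond_exp M (F (i - 1)) (?U i) x + real_cond_exp M (F (i - 1)) (?V i) x"
      using F.real_cond_exp_add[OF U[OF i] V[OF i]] by simp
    moreover have "AE x in M. real_cond_exp M (F (i - 1)) (X i) x = 0"
      using X i by (auto simp: mds_def)
    ultimately show "AE x in M. X i x = centred ?U i x + centred ?V i x"
      by eventually_elim (auto simp: centred_def)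
  qed simp
  have "prob {x \<in> space M. max_partial_sum X n x > c}
      \<le> prob ({x \<in> space M. \<bar>?SU x\<bar> \<ge> c / 2} \<union> {x \<in> space M. \<bar>?SV x\<bar> \<ge> c / 2})"
  proof (rule finite_measure_mono_AE)
    show "AE x in M. x \<in> {x \<in> space M. max_partial_sum X n x > c} \<longrightarrow>
        x \<in> {x \<in> space M. \<bar>?SU x\<bar> \<ge> c / 2} \<union> {x \<in> space M. \<bar>?SV x\<bar> \<ge> c / 2}"
      using eq
    proof eventually_elim
      case (elim x)
      have "(\<Sum>i = 1..n. ?H i x * X i x) = ?SU x + ?SV x"
        using elim unfolding partial_sum_def sum.distrib[symmetric]
        by (intro sum.cong) (auto simp: distrib_left)
      then show ?case using stopped_partial_sum_gt[OF n, of c X x] by auto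
    qed
  qed measurable
  also have "\<dots> \<le> prob {x \<in> space M. \<bar>?SU x\<bar> \<ge> c / 2} + prob {x \<in> space M. \<bar>?SV x\<bar> \<ge> c / 2}"
    by (intro measure_Un_le) measurable
  also have "\<dots> \<le> moment_const s * 2 powr (s + 2) * real n powr (s / 2) * L / (c / 2) powr s
      + moment_const q * 2 powr (q + 2) * real n powr (q / 2) * K / (c / 2) powr q"
    using c by (intro add_mono prob_partial_sum_centred_ge s q U UF V VF small large H H1) auto
  finally show ?thesis .
qed

end

section \<open>Choice of the exponents and summation\<close>

theorem theorem5p2:
  fixes M :: "'a measure" and X :: "nat \<Rightarrow> 'a \<Rightarrow> real"
    and f :: "real \<Rightarrow> real" and p q r :: real
  assumes "prob_space M"
    and "\<And>x. x \<ge> 0 \<Longrightarrow> f x > 0"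
    and "mono_on {0..} f"
    and "summable (\<lambda>n. 1 / f (2 ^ Suc n))"
    and "0 < r" and "r < 2" and "2 \<le> p"
    and "q = 2 * (p - r) / (2 - r)"
    and "martingale_difference_seq M X"
    and "(SUP n\<in>{1..}. \<integral>\<^sup>+ \<omega>. ennreal (\<bar>X n \<omega>\<bar> powr q * f \<bar>X n \<omega>\<bar>) \<partial>M) < \<infinity>"
  shows "\<forall>\<epsilon>>0. summable (\<lambda>n. real (Suc n) powr (p / r - 2) *
           measure M {\<omega> \<in> space M. max_partial_sum X (Suc n) \<omega> > \<epsilon> * real (Suc n) powr (1 / r)})"
proof (intro allI impI)
  fix \<epsilon> :: real
  assume \<epsilon>: "\<epsilon> > 0"
  note f_pos = assms(2) and r = \<open>0 < r\<close> \<open>r < 2\<close>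
  have f_mono: "f x \<le> f y" if "0 \<le> x" "x \<le> y" for x y
    using \<open>mono_on {0..} f\<close> that by (auto simp: mono_on_def)
  interpret prob_space M by fact
  obtain F where F: "filtration (space M) F" "\<And>n. subalgebra M (F n)"
    and X: "\<And>n. n \<ge> 1 \<Longrightarrow> integrable M (X n) \<and> X n \<in> borel_measurable (F n) \<and>
               (AE \<omega> in M. real_cond_exp M (F (n - 1)) (X n) \<omega> = 0)"
    using \<open>martingale_difference_seq M X\<close> unfolding martingale_difference_seq_def by blast
  interpret filtered_prob_space M F
    using F by unfold_locales (auto dest: filtration.sets_F_mono)
  have mds_X: "mds X" using X by (simp add: mds_def)

  \<comment> \<open>Equivalent to p - r \<ge> 2 - r.\<close>
  have q2: "q \<ge> 2"
    unfolding \<open>q = 2 * (p - r) / (2 - r)\<close> using r \<open>2 \<le> p\<close> by (simp add: field_simps)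
  define \<kappa> where "\<kappa> = 1 / r - 1 / 2"
  have "\<kappa> > 0" using r by (simp add: \<kappa>_def field_simps)
  then obtain N :: nat where N: "N > 0" "1 / real N < \<kappa>"
    using real_arch_inverse[of \<kappa>] by (auto simp: inverse_eq_divide)
  have q\<kappa>: "q * \<kappa> = p / r - 1"
  proof -
    have \<kappa>: "\<kappa> = (2 - r) / (2 * r)" using r by (simp add: \<kappa>_def field_simps)
    have "q * \<kappa> = (p - r) / r"
      unfolding \<kappa> \<open>q = 2 * (p - r) / (2 - r)\<close> using r by (simp del: right_diff_distrib_numeral)
    also have "\<dots> = p / r - 1" using r by (simp add: diff_divide_distrib)
    finally show ?thesis .
  qed

  define S where "S = (SUP n\<in>{1..}. \<integral>\<^sup>+ \<omega>. ennreal (\<bar>X n \<omega>\<bar> powr q * f \<bar>X n \<omega>\<bar>) \<partial>M)"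
  define K where "K = enn2real S"
  have K: "(\<integral>\<^sup>+ \<omega>. ennreal (\<bar>X i \<omega>\<bar> powr q * f \<bar>X i \<omega>\<bar>) \<partial>M) \<le> ennreal K" if "i \<ge> 1" for i
  proof -
    have "ennreal K = S" using assms(10) by (simp add: K_def S_def less_top)
    then show ?thesis using that by (auto simp: S_def intro: SUP_upper)
  qed
  \<comment> \<open>Used twice: with \<open>a = f 0 / b\<close> for the small part and with
    \<open>a = f b\<close> for the large part.\<close>
  have dominated: "integrable M g \<and> (\<integral>\<omega>. g \<omega> \<partial>M) \<le> K / a"
    if i: "i \<ge> 1" and a: "a > 0" and g: "g \<in> borel_measurable M" "\<And>\<omega>. 0 \<le> g \<omega>"
      and le: "\<And>\<omega>. a * g \<omega> \<le> \<bar>X i \<omega>\<bar> powr q * f \<bar>X i \<omega>\<bar>" for i a g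
  proof -
    have nn: "(\<integral>\<^sup>+ \<omega>. ennreal (a * g \<omega>) \<partial>M) \<le> ennreal K"
      using K[OF i] by (rule order_trans[rotated]) (intro nn_integral_mono ennreal_leI le)
    have int: "integrable M (\<lambda>\<omega>. a * g \<omega>)"
      using g a nn by (intro integrableI_bounded) (auto simp: le_less_trans)
    moreover have "ennreal (\<integral>\<omega>. a * g \<omega> \<partial>M) \<le> ennreal K"
      using nn_integral_eq_integral[OF int] g a nn by simp
    then have "(\<integral>\<omega>. a * g \<omega> \<partial>M) \<le> K" by (subst (asm) ennreal_le_iff) (simp_all add: K_def)
    ultimately show ?thesis using a by (simp add: field_simps)
  qed

  let ?A = "\<lambda>s a. moment_const s * 2 powr (s + 2) * a / (\<epsilon> / 2) powr s"
  let ?h1 = "\<lambda>n. ?A (q + 1) (K / f 0) * real n powr (- 1 - (\<kappa> - 1 / real N))"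
  let ?h2 = "\<lambda>n. ?A q K * (1 / (real n * f (real n powr (1 / real N))))"
  let ?t = "\<lambda>n. real n powr (p / r - 2) *
      prob {\<omega> \<in> space M. max_partial_sum X n \<omega> > \<epsilon> * real n powr (1 / r)}"
  have bound: "?t n \<le> ?h1 n + ?h2 n" if n: "n \<ge> 1" for n
  proof -
    define x where "x = real n"
    have x: "x > 0" using n by (simp add: x_def)
    define b where "b = x powr (1 / real N)"
    have b: "b > 0" using x by (simp add: b_def)
    have "prob {\<omega> \<in> space M. max_partial_sum X n \<omega> > \<epsilon> * x powr (1 / r)}
      \<le> moment_const (q + 1) * 2 powr (q + 1 + 2) * real n powr ((q + 1) / 2) * (K / (f 0 / b))
          / (\<epsilon> * x powr (1 / r) / 2) powr (q + 1)
        + moment_const q * 2 powr (q + 2) * real n powr (q / 2) * (K / f b)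
          / (\<epsilon> * x powr (1 / r) / 2) powr q"
    proof (rule prob_max_partial_sum_gt[OF mds_X, where b = b])
      fix i :: nat assume i: "i \<ge> 1"
      have [measurable]: "X i \<in> borel_measurable M" using X[OF i] by auto
      \<comment> \<open>Where |X_i| \<le> b, the additional factor |X_i| is at most
        \<open>b\<close>, and f(0) \<le> f(|X_i|).\<close>
      have "f 0 / b * \<bar>if \<bar>X i \<omega>\<bar> \<le> b then X i \<omega> else 0\<bar> powr (q + 1) \<le> \<bar>X i \<omega>\<bar> powr q * f \<bar>X i \<omega>\<bar>" for \<omega>
      proof (cases "\<bar>X i \<omega>\<bar> \<le> b")
        case True
        have "f 0 * (\<bar>X i \<omega>\<bar> powr q * \<bar>X i \<omega>\<bar>) \<le> f \<bar>X i \<omega>\<bar> * (\<bar>X i \<omega>\<bar> powr q * b)"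
          using True f_mono[of 0 "\<bar>X i \<omega>\<bar>"] f_pos[of 0] f_pos[of "\<bar>X i \<omega>\<bar>"]
          by (intro mult_mono mult_left_mono) auto
        then show ?thesis using True b by (simp add: powr_add field_simps)
      next
        case False
        then show ?thesis using f_pos[of "\<bar>X i \<omega>\<bar>"] by simp
      qed
      note small = dominated[OF i _ _ _ this]
      show "integrable M (\<lambda>\<omega>. \<bar>if \<bar>X i \<omega>\<bar> \<le> b then X i \<omega> else 0\<bar> powr (q + 1))"
        "(\<integral>\<omega>. \<bar>if \<bar>X i \<omega>\<bar> \<le> b then X i \<omega> else 0\<bar> powr (q + 1) \<partial>M) \<le> K / (f 0 / b)"
        using small f_pos[of 0] b by auto
      \<comment> \<open>Where |X_i| > b, monotonicity gives f(b) \<le> f(|X_i|); elsewhere the left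
        side is 0.\<close>
      have "f b * \<bar>if \<bar>X i \<omega>\<bar> \<le> b then 0 else X i \<omega>\<bar> powr q \<le> \<bar>X i \<omega>\<bar> powr q * f \<bar>X i \<omega>\<bar>" for \<omega>
        using f_mono[of b "\<bar>X i \<omega>\<bar>"] f_pos[of "\<bar>X i \<omega>\<bar>"] b
        by (auto simp: mult.commute[of _ "f _"] intro!: mult_right_mono)
      note large = dominated[OF i _ _ _ this]
      show "integrable M (\<lambda>\<omega>. \<bar>if \<bar>X i \<omega>\<bar> \<le> b then 0 else X i \<omega>\<bar> powr q)"
        "(\<integral>\<omega>. \<bar>if \<bar>X i \<omega>\<bar> \<le> b then 0 else X i \<omega>\<bar> powr q \<partial>M) \<le> K / f b"
        using large f_pos[of b] b by auto
    qed (use q2 n \<epsilon> x in auto)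
    also have "\<dots> = ?A (q + 1) (K / f 0) * (x powr ((q + 1) / 2) * x powr (1 / real N) / x powr ((q + 1) / r))
        + ?A q K * (x powr (q / 2) / x powr (q / r) / f b)"
    proof -
      have "(\<epsilon> * x powr (1 / r) / 2) powr s = (\<epsilon> / 2) powr s * x powr (s / r)" for s
        using \<epsilon> x powr_mult[of "\<epsilon> / 2" "x powr (1 / r)" s] by (simp add: powr_powr)
      then show ?thesis by (simp add: b_def x_def mult_ac)
    qed
    finally have "?t n \<le> x powr (p / r - 2) *
        (?A (q + 1) (K / f 0) * (x powr ((q + 1) / 2) * x powr (1 / real N) / x powr ((q + 1) / r))
        + ?A q K * (x powr (q / 2) / x powr (q / r) / f b))"
      unfolding x_def by (intro mult_left_mono) auto
    also have "\<dots> = ?A (q + 1) (K / f 0) *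
          x powr (p / r - 2 + (q + 1) / 2 + 1 / real N - (q + 1) / r)
        + ?A q K * (x powr (p / r - 2 + q / 2 - q / r) / f b)"
      using x unfolding powr_add powr_diff by (simp only: distrib_left) (simp add: mult_ac)
    \<comment> \<open>The exponent is p/r - 2 - (q + 1)\<kappa> + 1/N. The part with q\<kappa>
      leaves -1, the additional moment gains \<kappa>, and the truncation level loses 1/N.\<close>
    also have "p / r - 2 + (q + 1) / 2 + 1 / real N - (q + 1) / r = - 1 - (\<kappa> - 1 / real N)"
      using q\<kappa> by (simp add: \<kappa>_def algebra_simps add_divide_distrib)
    also have "p / r - 2 + q / 2 - q / r = - 1"
      using q\<kappa> by (simp add: \<kappa>_def algebra_simps)
    also have "x powr (- 1) / f b = 1 / (x * f b)"
      using x by (simp add: powr_minus field_simps)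
    finally show ?thesis by (simp add: x_def b_def)
  qed
  \<comment> \<open>The exponent in \<open>?h1\<close> is below -1 because 1/N < \<kappa>.\<close>
  have "summable (\<lambda>n. ?h1 n + ?h2 n)"
    using N summable_root_condensation[OF f_pos assms(3,4) N(1)]
    by (intro summable_add summable_mult) (auto simp: summable_real_powr_iff)
  \<comment> \<open>The comparison \<open>bound\<close> holds for n \<ge> 1 only, hence the shift of
    the index.\<close>
  then have "summable (\<lambda>n. ?h1 (Suc n) + ?h2 (Suc n))"
    by (subst summable_Suc_iff)
  then show "summable (\<lambda>n. ?t (Suc n))"
  proof (rule summable_comparison_test'[where N = 0])
    show "norm (?t (Suc n)) \<le> ?h1 (Suc n) + ?h2 (Suc n)" for n
      using bound[of "Suc n"] by (simp del: of_nat_Suc)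
  qed
qed

end
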